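(* Let $X$ and $Y$ be absolutely continuous random variables supported on a common set $S$, with probability density functions $f$ and $g$ respectively, and let $\epsilon>0$. Then $$\mathrm{VarJ}(X,Y)\ \geq\ \epsilon^2\Big\{P\big[g(X)\geq 2(\epsilon-J(X,Y))\big]+P\big[g(X)\leq 2(-\epsilon-J(X,Y))\big]\Big\}.$$
   Context: The extropy inaccuracy of $X$ and $Y$ is $J(X,Y)=-\frac12\int_S f(x)g(x)\,dx$. The varjinaccuracy (measure of inaccuracy of $X$ about $Y$ based on varextropy) is $$\mathrm{VarJ}(X,Y)=\mathrm{Var}_f\!\left[-\tfrac12 g(X)\right]=\frac14\int_S g^2(x)f(x)\,dx-\left[J(X,Y)\right]^2,$$ where $\mathrm{Var}_f$ denotes variance when $X$ has density $f$. The integrals appearing in these quantities are assumed to be finite. *)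

theory Defs
  imports "HOL-Probability.Probability"
begin

definition extropy_inaccuracy :: "real set \<Rightarrow> (real \<Rightarrow> real) \<Rightarrow> (real \<Rightarrow> real) \<Rightarrow> real"
  where "extropy_inaccuracy S f g = - (1 / 2) * (LINT x:S|lborel. f x * g x)"

text \<open>The measure with density \<open>f\<close> is the law of a random variable \<open>X\<close> with density \<open>f\<close>, so this
  is the variance of \<open>- g X / 2\<close>. The usual formula in terms of integrals over the support is
  \<open>varjinaccuracy_eq\<close> below.\<close>

definition varjinaccuracy :: "(real \<Rightarrow> real) \<Rightarrow> (real \<Rightarrow> real) \<Rightarrow> real"
  where "varjinaccuracy f g =
    prob_space.variance (density lborel (\<lambda>x. ennreal (f x))) (\<lambda>x. - (1 / 2) * g x)"

lemma varjinaccuracy_eq: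
  fixes f g :: "real \<Rightarrow> real"
  assumes f: "f \<in> borel_measurable borel" "\<And>x. 0 \<le> f x"
    and g: "g \<in> borel_measurable borel"
    and S: "S \<in> sets borel" "AE x in lborel. x \<notin> S \<longrightarrow> f x = 0"
    and one: "(\<integral>\<^sup>+ x. ennreal (f x) \<partial>lborel) = 1"
    and fg: "set_integrable lborel S (\<lambda>x. f x * g x)"
    and ggf: "set_integrable lborel S (\<lambda>x. (g x)\<^sup>2 * f x)"
  shows "varjinaccuracy f g =
    1 / 4 * (LINT x:S|lborel. (g x)\<^sup>2 * f x) - (extropy_inaccuracy S f g)\<^sup>2"
proof -
  let ?D = "density lborel (\<lambda>x. ennreal (f x))"
  note [measurable] = f(1) g S(1)
  interpret prob_space ?D
    by (rule prob_spaceI) (simp add: emeasure_density one)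
  have ae: "AE x in lborel. indicator S x *\<^sub>R (h x * f x) = f x *\<^sub>R h x" for h :: "real \<Rightarrow> real"
    using S(2) by eventually_elim (auto simp: indicator_def)
  have int: "integrable ?D h" and eq: "integral\<^sup>L ?D h = (LINT x:S|lborel. h x * f x)"
    if [measurable]: "h \<in> borel_measurable borel"
      and i: "set_integrable lborel S (\<lambda>x. h x * f x)" for h :: "real \<Rightarrow> real"
  proof -
    have "integrable lborel (\<lambda>x. f x *\<^sub>R h x) \<longleftrightarrow> set_integrable lborel S (\<lambda>x. h x * f x)"
      unfolding set_integrable_def using ae[of h] by (intro integrable_cong_AE) auto
    then show "integrable ?D h"
      using i f by (subst integrable_density) auto
    have "integral\<^sup>L ?D h = (\<integral>x. f x *\<^sub>R h x \<partial>lborel)"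
      using f by (subst integral_density) auto
    also have "\<dots> = (LINT x:S|lborel. h x * f x)"
      unfolding set_lebesgue_integral_def using ae[of h] by (intro integral_cong_AE) auto
    finally show "integral\<^sup>L ?D h = (LINT x:S|lborel. h x * f x)" .
  qed
  have gf: "set_integrable lborel S (\<lambda>x. g x * f x)"
    using fg by (simp add: mult.commute)
  have i1: "integrable ?D (\<lambda>x. - (1 / 2) * g x)"
    using int[OF g gf] by (rule integrable_mult_right)
  have sq: "(- (1 / 2) * g x)\<^sup>2 = 1 / 4 * (g x)\<^sup>2" for x
    by (simp add: power2_eq_square)
  have i2: "integrable ?D (\<lambda>x. (- (1 / 2) * g x)\<^sup>2)"
    unfolding sq using int[of "\<lambda>x. (g x)\<^sup>2", OF _ ggf] by (intro integrable_mult_right) simp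
  have e2: "expectation (\<lambda>x. (- (1 / 2) * g x)\<^sup>2) = 1 / 4 * (LINT x:S|lborel. (g x)\<^sup>2 * f x)"
    unfolding sq using eq[of "\<lambda>x. (g x)\<^sup>2", OF _ ggf] by simp
  have e1: "expectation (\<lambda>x. - (1 / 2) * g x) = extropy_inaccuracy S f g"
    unfolding extropy_inaccuracy_def using eq[OF g gf] by (simp add: mult.commute)
  show ?thesis
    unfolding varjinaccuracy_def by (subst variance_eq[OF i1 i2]) (simp only: e1 e2)
qed

end

theory Submission
  imports Defs
begin

text \<open>This is Chebyshev's inequality for the random variable -g(X)/2, whose mean is J(X,Y) and
  whose variance is VarJ(X,Y). The event that it deviates from its mean by at least \<epsilon> is a
  disjoint union of two tails, and solving each for g(X) gives the two events of the theorem
  (\<open>Chebyshev_inequality_tails\<close>). The rest is translation: the law of X is the measure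
  with density f, and since X lies in S almost surely, f vanishes almost everywhere off S, so
  expectations under this law are integrals over S.\<close>

text \<open>The law of X is \<open>density N f\<close> and gives no mass to the complement of S, so
  f cannot be positive there except on a null set. This turns the probabilistic notion of support
  into one that integrals can use.\<close>

lemma AE_density_zero_outside:
  fixes f :: "'b \<Rightarrow> real"
  assumes X: "distributed M N X (\<lambda>x. ennreal (f x))"
    and nonneg: "\<And>x. 0 \<le> f x"
    and S: "S \<in> sets N"
    and supp: "AE \<omega> in M. X \<omega> \<in> S"
  shows "AE x in N. x \<notin> S \<longrightarrow> f x = 0"
proof -
  have [measurable]: "X \<in> measurable M N" "(\<lambda>x. ennreal (f x)) \<in> borel_measurable N"
    using X by (auto dest: distributed_measurable distributed_borel_measurable)
  have "AE x in distr M N X. x \<in> S"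
    using supp S by (subst AE_distr_iff) simp_all
  then have "AE x in density N (\<lambda>x. ennreal (f x)). x \<in> S"
    by (simp only: distributed_distr_eq_density[OF X])
  then have "AE x in N. 0 < ennreal (f x) \<longrightarrow> x \<in> S"
    by (subst (asm) AE_density) auto
  then show ?thesis
    by eventually_elim (metis ennreal_less_zero_iff nonneg order_le_less)
qed

text \<open>Since f vanishes almost everywhere off S, inserting the indicator of S does not change
  the integrand. This links moments under the law of X to the set integrals that define J and
  express the finiteness hypotheses.\<close>

lemma
  fixes f h :: "'b \<Rightarrow> real"
  assumes f: "f \<in> borel_measurable N" "\<And>x. 0 \<le> f x"
    and h: "h \<in> borel_measurable N"
    and S: "S \<in> sets N" "AE x in N. x \<notin> S \<longrightarrow> f x = 0"
  shows integrable_density_iff_set_integrable: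
      "integrable (density N (\<lambda>x. ennreal (f x))) h \<longleftrightarrow> set_integrable N S (\<lambda>x. f x * h x)"
    and integral_density_eq_set_integral:
      "integral\<^sup>L (density N (\<lambda>x. ennreal (f x))) h = (LINT x:S|N. f x * h x)"
proof -
  note [measurable] = f(1) h S(1)
  have ae: "AE x in N. f x *\<^sub>R h x = indicator S x *\<^sub>R (f x * h x)"
    using S(2) by eventually_elim (auto simp: indicator_def)
  show "integrable (density N (\<lambda>x. ennreal (f x))) h \<longleftrightarrow> set_integrable N S (\<lambda>x. f x * h x)"
    unfolding set_integrable_def using f(2) integrable_cong_AE[OF _ _ ae]
    by (subst integrable_density) simp_all
  show "integral\<^sup>L (density N (\<lambda>x. ennreal (f x))) h = (LINT x:S|N. f x * h x)"
    unfolding set_lebesgue_integral_def using ae f(2)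
    by (subst integral_density) (auto simp del: real_scaleR_def intro!: integral_cong_AE)
qed

text \<open>The two tails together form the event of the two-sided Chebyshev bound. As a > 0 they
  are disjoint, so their probabilities add up to that of the event.\<close>

lemma (in prob_space) Chebyshev_inequality_tails:
  fixes h :: "'a \<Rightarrow> real"
  assumes [measurable]: "random_variable borel h"
    and "integrable M (\<lambda>x. (h x)\<^sup>2)" and "0 < a"
  shows "a\<^sup>2 * (prob {x \<in> space M. h x \<le> expectation h - a} +
      prob {x \<in> space M. h x \<ge> expectation h + a}) \<le> variance h"
proof -
  have "prob {x \<in> space M. h x \<le> expectation h - a} + prob {x \<in> space M. h x \<ge> expectation h + a}
      = prob ({x \<in> space M. h x \<le> expectation h - a} \<union> {x \<in> space M. h x \<ge> expectation h + a})"
    using \<open>0 < a\<close> by (intro finite_measure_Union[symmetric]) auto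
  also have "{x \<in> space M. h x \<le> expectation h - a} \<union> {x \<in> space M. h x \<ge> expectation h + a}
      = {x \<in> space M. a \<le> \<bar>h x - expectation h\<bar>}"
    by (auto simp: abs_if split: if_splits)
  also have "prob \<dots> \<le> variance h / a\<^sup>2"
    using assms by (rule Chebyshev_inequality)
  finally show ?thesis
    using \<open>0 < a\<close> by (simp add: pos_le_divide_eq mult.commute)
qed

theorem theorem3p9:
  fixes M :: "'a measure" and X Y :: "'a \<Rightarrow> real" and f g :: "real \<Rightarrow> real"
    and S :: "real set" and \<epsilon> :: real
  assumes "prob_space M"
    and f_nonneg: "\<And>x. 0 \<le> f x"
    and g_nonneg: "\<And>x. 0 \<le> g x"
    and X_density: "distributed M lborel X (\<lambda>x. ennreal (f x))"
    and Y_density: "distributed M lborel Y (\<lambda>x. ennreal (g x))"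
    and S_borel: "S \<in> sets borel"
    and X_supported: "AE \<omega> in M. X \<omega> \<in> S"
    and Y_supported: "AE \<omega> in M. Y \<omega> \<in> S"
    and fg_finite: "set_integrable lborel S (\<lambda>x. f x * g x)"
    and ggf_finite: "set_integrable lborel S (\<lambda>x. (g x)\<^sup>2 * f x)"
    and eps_pos: "\<epsilon> > 0"
  shows "varjinaccuracy f g \<ge> \<epsilon>\<^sup>2 *
    (measure M {\<omega> \<in> space M. g (X \<omega>) \<ge> 2 * (\<epsilon> - extropy_inaccuracy S f g)} +
     measure M {\<omega> \<in> space M. g (X \<omega>) \<le> 2 * (- \<epsilon> - extropy_inaccuracy S f g)})"
proof -
  let ?D = "density lborel (\<lambda>x. ennreal (f x))" and ?J = "extropy_inaccuracy S f g"
  let ?h = "\<lambda>x. - (1 / 2) * g x"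
  have [measurable]: "X \<in> borel_measurable M"
    using distributed_measurable[OF X_density] by simp
  have f: "f \<in> borel_measurable lborel" and g: "g \<in> borel_measurable lborel"
    using distributed_real_measurable[OF f_nonneg X_density]
      distributed_real_measurable[OF g_nonneg Y_density] by auto
  note [measurable] = f g
  have D: "distr M lborel X = ?D"
    by (rule distributed_distr_eq_density[OF X_density])
  interpret M: prob_space M by fact
  \<comment> \<open>\<open>?D\<close> is a probability measure because it is the law of X.\<close>
  interpret D: prob_space ?D
    unfolding D[symmetric] by (rule M.prob_space_distr) simp
  have S: "S \<in> sets lborel" "AE x in lborel. x \<notin> S \<longrightarrow> f x = 0"
    using S_borel AE_density_zero_outside[OF X_density f_nonneg _ X_supported] by auto
  have mean: "D.expectation ?h = ?J"
    unfolding extropy_inaccuracy_def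
    using integral_density_eq_set_integral[OF f f_nonneg g S] by simp
  \<comment> \<open>Finiteness of the integral of g^2 f over S is exactly the finite second moment
    that Chebyshev needs.\<close>
  have "integrable ?D (\<lambda>x. (g x)\<^sup>2)"
    using ggf_finite by (subst integrable_density_iff_set_integrable[OF f f_nonneg _ S])
      (auto simp: mult.commute)
  then have "integrable ?D (\<lambda>x. (?h x)\<^sup>2)"
    by (simp add: power_mult_distrib power_divide)
  from D.Chebyshev_inequality_tails[OF _ this eps_pos]
  have tails: "\<epsilon>\<^sup>2 * (D.prob {x \<in> space ?D. ?h x \<le> ?J - \<epsilon>} + D.prob {x \<in> space ?D. ?h x \<ge> ?J + \<epsilon>})
      \<le> varjinaccuracy f g"
    unfolding varjinaccuracy_def mean by simp
  \<comment> \<open>The tails are events on the real line under the law of X; their preimages under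
    X are the events of the theorem.\<close>
  have pull: "D.prob {x \<in> space ?D. P x} = measure M {\<omega> \<in> space M. P (X \<omega>)}"
    if [measurable]: "Measurable.pred borel P" for P
    unfolding D[symmetric] by (subst measure_distr) (auto intro!: arg_cong[where f = "measure M"])
  \<comment> \<open>Multiplying by -2 reverses the order, so the lower tail of \<open>?h\<close> is
    the upper tail of g and vice versa.\<close>
  have eqs: "?h x \<le> ?J - \<epsilon> \<longleftrightarrow> g x \<ge> 2 * (\<epsilon> - ?J)" "?h x \<ge> ?J + \<epsilon> \<longleftrightarrow> g x \<le> 2 * (- \<epsilon> - ?J)" for x
    by (auto simp: field_simps)
  show ?thesis
    using tails unfolding eqs by (subst (asm) (1 2) pull) simp_all
qed

end
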